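(* Almost surely, the sequence of random measures $(m_n)_{n\ge 1}$ is weakly convergent to a (random) measure $m$.
   Context: Let $\ell\ge 2$ be an integer. For $n\ge 1$ let $\mathcal{M}_n$ be the set of words $\varepsilon=\varepsilon_1\cdots\varepsilon_n$ of length $n$ with letters in $\{0,\dots,\ell-1\}$, let $\mathcal{M}=\bigcup_{n\ge 1}\mathcal{M}_n$, and let $I_{\varepsilon_1\cdots\varepsilon_n}=\left[\sum_{k=1}^n\frac{\varepsilon_k}{\ell^k},\ \sum_{k=1}^n\frac{\varepsilon_k}{\ell^k}+\frac1{\ell^n}\right)$. Let $W$ be a non-negative random variable with $E[W]=1$, and let $(W_\varepsilon)_{\varepsilon\in\mathcal{M}}$ be a family of independent copies of $W$. Let $\lambda$ be the Lebesgue measure on $[0,1]$ and define the random measures $$m_n=f_n\,\lambda,\qquad f_n=\sum_{\varepsilon_1\cdots\varepsilon_n\in\mathcal{M}_n}W_{\varepsilon_1}W_{\varepsilon_1\varepsilon_2}\cdots W_{\varepsilon_1\cdots\varepsilon_n}\,\mathbf 1_{I_{\varepsilon_1\cdots\varepsilon_n}}.$$ Weak convergence means convergence of integrals of every continuous function on $[0,1]$; the limit $m$ is a finite Borel measure on $[0,1]$. *)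

theory Defs
  imports "HOL-Probability.Probability"
begin

definition words :: "nat \<Rightarrow> nat \<Rightarrow> nat list set" where
  "words l n = {e. length e = n \<and> set e \<subseteq> {..<l}}"

definition nonempty_words :: "nat \<Rightarrow> nat list set" where
  "nonempty_words l = (\<Union>n\<in>{1..}. words l n)"

definition adic_left :: "nat \<Rightarrow> nat list \<Rightarrow> real" where
  "adic_left l e = (\<Sum>k=1..length e. real (e ! (k - 1)) / real l ^ k)"

definition adic_interval :: "nat \<Rightarrow> nat list \<Rightarrow> real set" where
  "adic_interval l e = {adic_left l e ..< adic_left l e + 1 / real l ^ length e}"

definition cascade_density ::
  "nat \<Rightarrow> (nat list \<Rightarrow> 'a \<Rightarrow> real) \<Rightarrow> nat \<Rightarrow> 'a \<Rightarrow> real \<Rightarrow> real" where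
  "cascade_density l V n \<omega> x =
     (\<Sum>e\<in>words l n. (\<Prod>k=1..n. V (take k e) \<omega>) * indicator (adic_interval l e) x)"

text \<open>Measures on the unit interval have the interval itself, rather than the whole real
  line, as their space. If the weights are only almost surely non-negative, the truncation of
  the density at zero by \<open>ennreal\<close> matters on a null set of \<open>\<omega>\<close> only.\<close>

definition cascade_measure ::
  "nat \<Rightarrow> (nat list \<Rightarrow> 'a \<Rightarrow> real) \<Rightarrow> nat \<Rightarrow> 'a \<Rightarrow> real measure" where
  "cascade_measure l V n \<omega> =
     density (restrict_space lborel {0..1}) (\<lambda>x. ennreal (cascade_density l V n \<omega> x))"

text \<open>\<^const>\<open>weak_conv_m\<close> is phrased through distribution functions, and \<^const>\<open>subprob_algebra\<close>
  only admits measures of total mass at most one, so neither fits here.\<close>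

definition weakly_convergent_to :: "(nat \<Rightarrow> real measure) \<Rightarrow> real measure \<Rightarrow> bool" where
  "weakly_convergent_to \<mu> \<nu> \<longleftrightarrow>
     (\<forall>g :: real \<Rightarrow> real. continuous_on {0..1} g \<longrightarrow>
        (\<lambda>n. \<integral>x. g x \<partial>\<mu> n) \<longlonglongrightarrow> (\<integral>x. g x \<partial>\<nu>))"

definition random_finite_measure :: "'a measure \<Rightarrow> ('a \<Rightarrow> real measure) \<Rightarrow> bool" where
  "random_finite_measure M m \<longleftrightarrow>
     (\<forall>\<omega>\<in>space M. finite_measure (m \<omega>) \<and> sets (m \<omega>) = sets (restrict_space borel {0..1})) \<and>
     (\<forall>A\<in>sets (restrict_space borel {0..1}). (\<lambda>\<omega>. emeasure (m \<omega>) A) \<in> borel_measurable M)"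

end

theory Submission
  imports Defs
begin

text \<open>Fix a Borel set \<open>B\<close>. Given the weights of the words of length at most \<open>n\<close>, the mass \<open>m\<^sub>n\<^sub>+\<^sub>1(B)\<close> has mean
  \<open>m\<^sub>n(B)\<close>: each weight of level \<open>n + 1\<close> is independent of the past with mean one, and the intervals of
  the children of a word partition its interval (\<open>cascade_mass_martingale\<close>). A non-negative martingale
  converges almost surely (\<open>AE_convergent\<close>). Applied to the countably many sets \<open>[0, q]\<close> with \<open>q\<close>
  rational, this gives almost surely limits \<open>G(q)\<close> of \<open>m\<^sub>n([0, q])\<close> for all of them at once.

  These limits determine the weak limit. At a rational atom \<open>q\<close> of the weak limit, mass that approaches \<open>q\<close>
  from the right is missing in \<open>G(q)\<close>, so \<open>G\<close> cannot simply be read as a distribution function. The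
  limit is obtained as the image of Lebesgue measure on \<open>[0, G(1))\<close> under the quantile function
  of \<open>G\<close>. A Riemann sum over a fine rational grid compares integrals of continuous functions with
  respect to \<open>m\<^sub>n\<close> and this image (\<open>weakly_convergent_to_quantile_measure\<close>). As the quantile function depends
  measurably on \<open>\<omega>\<close> and on its argument jointly, the limit is a random measure
  (\<open>random_finite_measure_quantile_measure\<close>).

  The martingale convergence theorem is derived without upcrossings. If \<open>Y\<close> is a non-negative
  martingale, then \<open>Z = exp (- Y)\<close> and \<open>Z\<^sup>2\<close> are bounded submartingales. Hence \<open>E Z\<^sub>n\<^sup>2\<close> increases to a finite
  limit, and the submartingale property gives \<open>E (Z\<^sub>\<tau> - Z\<^sub>m)\<^sup>2 \<le> E Z\<^sub>N\<^sup>2 - E Z\<^sub>m\<^sup>2\<close> for stopping times \<open>\<tau>\<close> between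
  \<open>m\<close> and \<open>N\<close>. With \<open>\<tau>\<close> the first time that \<open>Z\<close> is far from \<open>Z\<^sub>m\<close>, this is a maximal inequality
  (\<open>maximal_inequality\<close>) that makes \<open>Z\<close> a Cauchy sequence almost surely. So \<open>Y = - ln Z\<close> converges as well, unless
  \<open>Z\<close> tends to \<open>0\<close>, which Fatou's lemma excludes.\<close>

section \<open>Almost sure convergence of non-negative martingales\<close>

lemma exp_tangent_line:
  fixes a x y :: real
  shows "exp (- (a * y)) \<ge> exp (- (a * x)) - a * (exp (- (a * x)) * (y - x))"
proof -
  have "exp (- (a * x)) * (1 + - (a * (y - x))) \<le> exp (- (a * x)) * exp (- (a * (y - x)))"
    by (intro mult_left_mono exp_ge_add_one_self) simp
  also have "\<dots> = exp (- (a * y))"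
    by (simp flip: exp_add add: algebra_simps)
  finally show ?thesis by (simp add: algebra_simps)
qed

text \<open>Conditional expectations are avoided: the martingale property is tested against the
  \<open>F n\<close>-measurable variables with values in \<open>[0, 1]\<close>. All test variables that occur below (indicators of
  stopping events, \<open>exp (- a * Y m)\<close> with \<open>m \<le> n\<close>, and their products) have this
  form. Asking that \<open>Y i\<close> be \<open>F n\<close>-measurable for all \<open>i \<le> n\<close> stands in for monotonicity of \<open>F\<close>.\<close>

locale nonneg_martingale = prob_space +
  fixes F :: "nat \<Rightarrow> 'a measure" and Y :: "nat \<Rightarrow> 'a \<Rightarrow> real"
  assumes subalg: "\<And>n. subalgebra M (F n)"
    and adapted: "\<And>i n. i \<le> n \<Longrightarrow> Y i \<in> borel_measurable (F n)"
    and Y_integrable: "\<And>n. integrable M (Y n)"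
    and Y_nonneg: "\<And>n \<omega>. 0 \<le> Y n \<omega>"
    and martingale: "\<And>n h. h \<in> borel_measurable (F n) \<Longrightarrow> (\<And>\<omega>. 0 \<le> h \<omega>) \<Longrightarrow> (\<And>\<omega>. h \<omega> \<le> 1) \<Longrightarrow>
      expectation (\<lambda>\<omega>. h \<omega> * Y (Suc n) \<omega>) = expectation (\<lambda>\<omega>. h \<omega> * Y n \<omega>)"
begin

lemma measurable_F_imp_M: "h \<in> borel_measurable (F n) \<Longrightarrow> h \<in> borel_measurable M"
  using subalg measurable_from_subalg by blast

lemma Y_measurable [measurable]: "Y n \<in> borel_measurable M"
  using Y_integrable by auto

text \<open>A bounded transform of \<open>Y\<close>. As \<open>y \<mapsto> exp (- y)\<close> and its square are convex, both \<open>Z\<close> and \<open>Z\<^sup>2\<close> are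
  submartingales; convergence of \<open>Z\<close> gives convergence of \<open>Y\<close> in \<open>[0, \<infinity>]\<close>.\<close>

definition Z :: "nat \<Rightarrow> 'a \<Rightarrow> real" where "Z n \<omega> = exp (- Y n \<omega>)"

lemma Z_measurable [measurable]: "Z n \<in> borel_measurable M"
  unfolding Z_def by measurable

lemma Z_adapted: "i \<le> n \<Longrightarrow> Z i \<in> borel_measurable (F n)"
  unfolding Z_def using adapted[of i n] by measurable

lemma Z_nonneg: "0 \<le> Z n \<omega>" and Z_le_1: "Z n \<omega> \<le> 1"
  using Y_nonneg by (auto simp: Z_def)

lemma integrable_unit_bounded:
  "h \<in> borel_measurable M \<Longrightarrow> (\<And>\<omega>. 0 \<le> h \<omega>) \<Longrightarrow> (\<And>\<omega>. h \<omega> \<le> (1::real)) \<Longrightarrow> integrable M h"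
  by (rule integrable_const_bound[of _ 1]) auto

text \<open>Jensen's inequality in differential form: \<open>exp (- a * Y (Suc n))\<close> lies above the tangent line of
  the exponential at \<open>Y n\<close>, whose linear term has tested mean zero by the martingale property.\<close>

lemma exp_submartingale:
  assumes h: "h \<in> borel_measurable (F n)" "\<And>\<omega>. 0 \<le> h \<omega>" "\<And>\<omega>. h \<omega> \<le> 1" and "0 \<le> a"
  shows "expectation (\<lambda>\<omega>. h \<omega> * exp (- (a * Y n \<omega>))) \<le> expectation (\<lambda>\<omega>. h \<omega> * exp (- (a * Y (Suc n) \<omega>)))"
proof -
  let ?e = "\<lambda>i \<omega>. exp (- (a * Y i \<omega>))"
  have e: "0 \<le> ?e i \<omega>" "?e i \<omega> \<le> 1" for i \<omega>
    using \<open>0 \<le> a\<close> Y_nonneg[of i \<omega>] by auto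
  have he: "0 \<le> h \<omega> * ?e i \<omega>" "h \<omega> * ?e i \<omega> \<le> 1" for i \<omega>
    using h e by (auto intro: mult_le_one)
  have hM [measurable]: "h \<in> borel_measurable M"
    using h measurable_F_imp_M by blast
  have heF: "(\<lambda>\<omega>. h \<omega> * ?e n \<omega>) \<in> borel_measurable (F n)"
    using h(1) adapted[of n n] by measurable
  have int_he: "integrable M (\<lambda>\<omega>. h \<omega> * ?e i \<omega>)" for i
    by (rule integrable_unit_bounded) (use he in auto)
  have int_heY: "integrable M (\<lambda>\<omega>. (h \<omega> * ?e n \<omega>) * Y i \<omega>)" for i
  proof (rule Bochner_Integration.integrable_bound[OF Y_integrable[of i]])
    show "AE \<omega> in M. norm (h \<omega> * ?e n \<omega> * Y i \<omega>) \<le> norm (Y i \<omega>)"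
      using he Y_nonneg[of i] by (intro AE_I2) (simp add: mult_left_le_one_le)
  qed measurable
  have "expectation (\<lambda>\<omega>. h \<omega> * ?e n \<omega>)
      = expectation (\<lambda>\<omega>. h \<omega> * ?e n \<omega> - a * (h \<omega> * ?e n \<omega> * Y (Suc n) \<omega> - h \<omega> * ?e n \<omega> * Y n \<omega>))"
    using int_he int_heY martingale[OF heF he] by simp
  also have "\<dots> \<le> expectation (\<lambda>\<omega>. h \<omega> * ?e (Suc n) \<omega>)"
  proof (rule integral_mono)
    fix \<omega>
    have "h \<omega> * (?e n \<omega> - a * (?e n \<omega> * (Y (Suc n) \<omega> - Y n \<omega>))) \<le> h \<omega> * ?e (Suc n) \<omega>"
      using h exp_tangent_line by (intro mult_left_mono) auto
    then show "h \<omega> * ?e n \<omega> - a * (h \<omega> * ?e n \<omega> * Y (Suc n) \<omega> - h \<omega> * ?e n \<omega> * Y n \<omega>)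
        \<le> h \<omega> * ?e (Suc n) \<omega>"
      by (simp add: algebra_simps)
  qed (use int_he int_heY in auto)
  finally show ?thesis .
qed

lemma Z_submartingale:
  assumes "h \<in> borel_measurable (F n)" "\<And>\<omega>. 0 \<le> h \<omega>" "\<And>\<omega>. h \<omega> \<le> 1"
  shows "expectation (\<lambda>\<omega>. h \<omega> * Z n \<omega>) \<le> expectation (\<lambda>\<omega>. h \<omega> * Z (Suc n) \<omega>)"
    and "expectation (\<lambda>\<omega>. h \<omega> * (Z n \<omega>)\<^sup>2) \<le> expectation (\<lambda>\<omega>. h \<omega> * (Z (Suc n) \<omega>)\<^sup>2)"
  using exp_submartingale[OF assms, where a = 1] exp_submartingale[OF assms, where a = 2]
  by (simp_all add: Z_def flip: exp_double)

text \<open>The process \<open>Z m, Z (m + 1), \<dots>\<close> stopped when it first is at distance at least \<open>\<epsilon>\<close> from \<open>Z m\<close>.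
  Defined by recursion on the time after \<open>m\<close>, it does without an explicit stopping time.\<close>

primrec frozen :: "nat \<Rightarrow> real \<Rightarrow> nat \<Rightarrow> 'a \<Rightarrow> real" where
  "frozen m \<epsilon> 0 \<omega> = Z m \<omega>"
| "frozen m \<epsilon> (Suc k) \<omega> =
     (if \<epsilon> \<le> \<bar>frozen m \<epsilon> k \<omega> - Z m \<omega>\<bar> then frozen m \<epsilon> k \<omega> else Z (m + Suc k) \<omega>)"

lemma frozen_bounds: "0 \<le> frozen m \<epsilon> k \<omega>" "frozen m \<epsilon> k \<omega> \<le> 1"
  using Z_nonneg Z_le_1 by (induction k) auto

lemma frozen_adapted: "m + k \<le> n \<Longrightarrow> frozen m \<epsilon> k \<in> borel_measurable (F n)"
proof (induction k)
  case 0
  then have "Z m \<in> borel_measurable (F n)" by (intro Z_adapted) auto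
  then show ?case by (simp cong: measurable_cong)
next
  case (Suc k)
  have [measurable]: "frozen m \<epsilon> k \<in> borel_measurable (F n)" "Z m \<in> borel_measurable (F n)"
      "Z (m + Suc k) \<in> borel_measurable (F n)"
    using Suc by (auto intro!: Z_adapted)
  show ?case unfolding frozen.simps by measurable
qed

lemma frozen_measurable [measurable]: "frozen m \<epsilon> k \<in> borel_measurable M"
  using frozen_adapted measurable_F_imp_M by blast

lemma frozen_eq_unless_far:
  "\<bar>frozen m \<epsilon> k \<omega> - Z m \<omega>\<bar> < \<epsilon> \<Longrightarrow> frozen m \<epsilon> k \<omega> = Z (m + k) \<omega>"
  by (cases k) (auto split: if_splits)

lemma frozen_far:
  assumes "i \<le> k" "\<epsilon> \<le> \<bar>Z (m + i) \<omega> - Z m \<omega>\<bar>"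
  shows "\<epsilon> \<le> \<bar>frozen m \<epsilon> k \<omega> - Z m \<omega>\<bar>"
  using assms
proof (induction k)
  case (Suc k)
  show ?case
  proof (cases "i \<le> k")
    case False
    then have "i = Suc k" using Suc by auto
    then show ?thesis using Suc.prems by auto
  qed (use Suc in auto)
qed auto

lemma integrable_Z_power2: "integrable M (\<lambda>\<omega>. (Z n \<omega>)\<^sup>2)"
  by (rule integrable_unit_bounded) (use Z_nonneg Z_le_1 in \<open>auto intro: power_le_one\<close>)

text \<open>Optional stopping for the two submartingales, one step at a time. Here \<open>h\<close> is the indicator of
  not being stopped yet. The second moment of the stopped process grows at most as fast as that of
  \<open>Z\<close>, since \<open>Z\<^sup>2\<close> also increases in mean on the stopped part \<open>1 - h\<close>; the correlation with \<open>Z m\<close> can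
  only grow, since \<open>Z m * h\<close> is a non-negative test variable. The two bounds are what is needed to
  expand \<open>(frozen m \<epsilon> k - Z m)\<^sup>2\<close>.\<close>

lemma frozen_second_moment:
  "expectation (\<lambda>\<omega>. (frozen m \<epsilon> k \<omega>)\<^sup>2) \<le> expectation (\<lambda>\<omega>. (Z (m + k) \<omega>)\<^sup>2)"
  and frozen_correlation:
  "expectation (\<lambda>\<omega>. (Z m \<omega>)\<^sup>2) \<le> expectation (\<lambda>\<omega>. Z m \<omega> * frozen m \<epsilon> k \<omega>)"
proof (induction k)
  case 0
  { case 1 show ?case by simp }
  { case 2 show ?case by (simp add: power2_eq_square) }
next
  case (Suc k)
  define h where "h \<omega> = (if \<epsilon> \<le> \<bar>frozen m \<epsilon> k \<omega> - Z m \<omega>\<bar> then 0 else 1 :: real)" for \<omega>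
  have h: "h \<in> borel_measurable (F (m + k))" "0 \<le> h \<omega>" "h \<omega> \<le> 1" for \<omega>
  proof -
    have [measurable]: "frozen m \<epsilon> k \<in> borel_measurable (F (m + k))" "Z m \<in> borel_measurable (F (m + k))"
      by (auto intro: frozen_adapted Z_adapted)
    show "h \<in> borel_measurable (F (m + k))" unfolding h_def by measurable
  qed (auto simp: h_def)
  have [measurable]: "h \<in> borel_measurable M" using h measurable_F_imp_M by blast
  have frozen_Suc: "frozen m \<epsilon> (Suc k) \<omega> = frozen m \<epsilon> k \<omega> + h \<omega> * Z (Suc (m + k)) \<omega> - h \<omega> * Z (m + k) \<omega>"
    "(frozen m \<epsilon> (Suc k) \<omega>)\<^sup>2 = (frozen m \<epsilon> k \<omega>)\<^sup>2 + h \<omega> * (Z (Suc (m + k)) \<omega>)\<^sup>2 - h \<omega> * (Z (m + k) \<omega>)\<^sup>2" for \<omega>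
    using frozen_eq_unless_far[of m \<epsilon> k \<omega>] by (auto simp: h_def)
  note bounds = h(2,3) Z_nonneg Z_le_1 frozen_bounds
  have int: "integrable M (\<lambda>\<omega>. (frozen m \<epsilon> k \<omega>)\<^sup>2)" "integrable M (\<lambda>\<omega>. h \<omega> * (Z i \<omega>)\<^sup>2)"
    "integrable M (\<lambda>\<omega>. Z m \<omega> * frozen m \<epsilon> k \<omega>)" "integrable M (\<lambda>\<omega>. (Z m \<omega> * h \<omega>) * Z i \<omega>)" for i
    by (rule integrable_unit_bounded; use bounds in \<open>auto intro!: mult_le_one power_le_one\<close>)+
  { case 1
    have "expectation (\<lambda>\<omega>. (1 - h \<omega>) * (Z (m + k) \<omega>)\<^sup>2) \<le> expectation (\<lambda>\<omega>. (1 - h \<omega>) * (Z (Suc (m + k)) \<omega>)\<^sup>2)"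
      using h by (intro Z_submartingale) auto
    then have "expectation (\<lambda>\<omega>. (Z (m + k) \<omega>)\<^sup>2) - expectation (\<lambda>\<omega>. h \<omega> * (Z (m + k) \<omega>)\<^sup>2)
        \<le> expectation (\<lambda>\<omega>. (Z (Suc (m + k)) \<omega>)\<^sup>2) - expectation (\<lambda>\<omega>. h \<omega> * (Z (Suc (m + k)) \<omega>)\<^sup>2)"
      using int integrable_Z_power2 by (simp add: left_diff_distrib)
    moreover have "expectation (\<lambda>\<omega>. (frozen m \<epsilon> (Suc k) \<omega>)\<^sup>2) = expectation (\<lambda>\<omega>. (frozen m \<epsilon> k \<omega>)\<^sup>2)
        + expectation (\<lambda>\<omega>. h \<omega> * (Z (Suc (m + k)) \<omega>)\<^sup>2) - expectation (\<lambda>\<omega>. h \<omega> * (Z (m + k) \<omega>)\<^sup>2)"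
      unfolding frozen_Suc(2) using int by simp
    ultimately show ?case using Suc by simp }
  { case 2
    have "expectation (\<lambda>\<omega>. (Z m \<omega> * h \<omega>) * Z (m + k) \<omega>) \<le> expectation (\<lambda>\<omega>. (Z m \<omega> * h \<omega>) * Z (Suc (m + k)) \<omega>)"
      using h Z_adapted[of m "m + k"] bounds
      by (intro Z_submartingale borel_measurable_times) (auto intro!: mult_le_one)
    moreover have "expectation (\<lambda>\<omega>. Z m \<omega> * frozen m \<epsilon> (Suc k) \<omega>) = expectation (\<lambda>\<omega>. Z m \<omega> * frozen m \<epsilon> k \<omega>
        + (Z m \<omega> * h \<omega>) * Z (Suc (m + k)) \<omega> - (Z m \<omega> * h \<omega>) * Z (m + k) \<omega>)"
      unfolding frozen_Suc(1) by (simp add: algebra_simps)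
    ultimately show ?case using Suc int by simp }
qed

text \<open>On the event in question the stopped process ends at distance at least \<open>\<epsilon>\<close> from \<open>Z m\<close>, so
  Markov's inequality applies to its squared distance, whose mean is bounded by optional stopping.\<close>

lemma maximal_inequality:
  assumes "0 < \<epsilon>"
  shows "\<epsilon>\<^sup>2 * prob {\<omega> \<in> space M. \<exists>i\<le>k. \<epsilon> \<le> \<bar>Z (m + i) \<omega> - Z m \<omega>\<bar>}
    \<le> expectation (\<lambda>\<omega>. (Z (m + k) \<omega>)\<^sup>2) - expectation (\<lambda>\<omega>. (Z m \<omega>)\<^sup>2)"
proof -
  let ?S = "frozen m \<epsilon> k" and ?B = "{\<omega> \<in> space M. \<exists>i\<le>k. \<epsilon> \<le> \<bar>Z (m + i) \<omega> - Z m \<omega>\<bar>}"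
  note bounds = Z_nonneg Z_le_1 frozen_bounds
  have int: "integrable M (\<lambda>\<omega>. (?S \<omega>)\<^sup>2)" "integrable M (\<lambda>\<omega>. Z m \<omega> * ?S \<omega>)"
    by (rule integrable_unit_bounded; use bounds in \<open>auto intro!: mult_le_one power_le_one\<close>)+
  have sq: "(?S \<omega> - Z m \<omega>)\<^sup>2 = (?S \<omega>)\<^sup>2 + (Z m \<omega>)\<^sup>2 - 2 * (Z m \<omega> * ?S \<omega>)" for \<omega>
    by (simp add: power2_eq_square algebra_simps)
  have B [measurable]: "?B \<in> events" by measurable
  have "\<epsilon>\<^sup>2 * prob ?B = expectation (\<lambda>\<omega>. \<epsilon>\<^sup>2 * indicator ?B \<omega>)"
    by simp
  also have "\<dots> \<le> expectation (\<lambda>\<omega>. (?S \<omega> - Z m \<omega>)\<^sup>2)"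
  proof (rule integral_mono)
    show "integrable M (\<lambda>\<omega>. (?S \<omega> - Z m \<omega>)\<^sup>2)"
      unfolding sq using int integrable_Z_power2 by auto
    show "\<epsilon>\<^sup>2 * indicator ?B \<omega> \<le> (?S \<omega> - Z m \<omega>)\<^sup>2" for \<omega>
      using frozen_far[of _ k \<epsilon> m \<omega>] \<open>0 < \<epsilon>\<close>
      by (auto simp: indicator_def simp flip: abs_le_square_iff)
  qed (intro integrable_mult_right integrable_real_indicator B, simp add: emeasure_eq_measure)
  also have "\<dots> \<le> expectation (\<lambda>\<omega>. (Z (m + k) \<omega>)\<^sup>2) - expectation (\<lambda>\<omega>. (Z m \<omega>)\<^sup>2)"
    unfolding sq using int integrable_Z_power2 frozen_second_moment[of m \<epsilon> k] frozen_correlation[of m \<epsilon> k]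
    by simp
  finally show ?thesis .
qed

lemma second_moments_converge: "convergent (\<lambda>n. expectation (\<lambda>\<omega>. (Z n \<omega>)\<^sup>2))"
proof -
  have "incseq (\<lambda>n. expectation (\<lambda>\<omega>. (Z n \<omega>)\<^sup>2))"
    using Z_submartingale(2)[of "\<lambda>_. 1"] by (intro incseq_SucI) simp
  moreover have "expectation (\<lambda>\<omega>. (Z n \<omega>)\<^sup>2) \<le> expectation (\<lambda>_. 1)" for n
    by (intro integral_mono integrable_Z_power2) (use Z_nonneg Z_le_1 in \<open>auto intro: power_le_one\<close>)
  ultimately show ?thesis
    using incseq_convergent[of "\<lambda>n. expectation (\<lambda>\<omega>. (Z n \<omega>)\<^sup>2)" 1] convergentI
    by (metis lebesgue_integral_const prob_space scaleR_one)
qed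

text \<open>The event that \<open>Z\<close> moves away from \<open>Z m\<close> by \<open>\<epsilon>\<close> at some time after \<open>m\<close> has probability at most
  \<open>(c - E (Z m)\<^sup>2) / \<epsilon>\<^sup>2\<close>, where \<open>c\<close> is the limit of the second moments; this tends to \<open>0\<close> with \<open>m\<close>.\<close>

lemma AE_eventually_close:
  assumes "0 < \<epsilon>"
  shows "AE \<omega> in M. \<exists>m. \<forall>i. \<bar>Z (m + i) \<omega> - Z m \<omega>\<bar> < \<epsilon>"
proof -
  let ?b = "\<lambda>n. expectation (\<lambda>\<omega>. (Z n \<omega>)\<^sup>2)"
  define B where "B m k = {\<omega> \<in> space M. \<exists>i\<le>k. \<epsilon> \<le> \<bar>Z (m + i) \<omega> - Z m \<omega>\<bar>}" for m k
  have B [measurable]: "B m k \<in> events" for m k unfolding B_def by measurable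
  obtain c where c: "?b \<longlonglongrightarrow> c" using second_moments_converge by (auto simp: convergent_def)
  have le: "prob (\<Union>k. B m k) \<le> (c - ?b m) / \<epsilon>\<^sup>2" for m
  proof (rule LIMSEQ_le)
    show "(\<lambda>k. prob (B m k)) \<longlonglongrightarrow> prob (\<Union>k. B m k)"
      by (rule finite_Lim_measure_incseq) (auto simp: incseq_def B_def intro: order_trans)
    show "(\<lambda>k. (?b (m + k) - ?b m) / \<epsilon>\<^sup>2) \<longlonglongrightarrow> (c - ?b m) / \<epsilon>\<^sup>2"
      using LIMSEQ_ignore_initial_segment[OF c, of m] \<open>0 < \<epsilon>\<close> by (auto intro!: tendsto_intros simp: add.commute)
    show "\<exists>N. \<forall>n\<ge>N. prob (B m n) \<le> (?b (m + n) - ?b m) / \<epsilon>\<^sup>2"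
      using maximal_inequality[OF \<open>0 < \<epsilon>\<close>] \<open>0 < \<epsilon>\<close>
      unfolding B_def by (intro exI[of _ 0] allI impI) (simp add: pos_le_divide_eq mult.commute)
  qed
  have "prob (\<Inter>m. \<Union>k. B m k) \<le> 0"
  proof (rule LIMSEQ_le_const)
    show "(\<lambda>m. (c - ?b m) / \<epsilon>\<^sup>2) \<longlonglongrightarrow> 0"
      using c \<open>0 < \<epsilon>\<close> by (auto intro!: tendsto_eq_intros)
    show "\<exists>N. \<forall>m\<ge>N. prob (\<Inter>m. \<Union>k. B m k) \<le> (c - ?b m) / \<epsilon>\<^sup>2"
      by (auto intro!: exI[of _ 0] order_trans[OF _ le] finite_measure_mono)
  qed
  then have "prob (\<Inter>m. \<Union>k. B m k) = 0"
    by (simp add: measure_le_0_iff)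
  then have "(\<Inter>m. \<Union>k. B m k) \<in> null_sets M"
    by (intro null_setsI) (auto simp: emeasure_eq_measure)
  then show ?thesis
    by (rule AE_I') (force simp: B_def not_less)
qed

lemma AE_Z_convergent: "AE \<omega> in M. convergent (\<lambda>n. Z n \<omega>)"
proof -
  have "AE \<omega> in M. \<forall>j::nat. \<exists>m. \<forall>i. \<bar>Z (m + i) \<omega> - Z m \<omega>\<bar> < inverse (real (Suc j))"
    by (subst AE_all_countable) (auto intro: AE_eventually_close)
  then show ?thesis
  proof (rule AE_mp, intro AE_I2 impI)
    fix \<omega> assume *: "\<forall>j::nat. \<exists>m. \<forall>i. \<bar>Z (m + i) \<omega> - Z m \<omega>\<bar> < inverse (real (Suc j))"
    have "Cauchy (\<lambda>n. Z n \<omega>)"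
    proof (rule metric_CauchyI)
      fix e :: real assume "0 < e"
      then obtain j where j: "inverse (real (Suc j)) < e / 2"
        using reals_Archimedean[of "e / 2"] by auto
      obtain m where m: "\<And>i. \<bar>Z (m + i) \<omega> - Z m \<omega>\<bar> < inverse (real (Suc j))"
        using * by blast
      have "dist (Z p \<omega>) (Z q \<omega>) < e" if "p \<ge> m" "q \<ge> m" for p q
        using m[of "p - m"] m[of "q - m"] that j by (auto simp: dist_real_def)
      then show "\<exists>N. \<forall>p\<ge>N. \<forall>q\<ge>N. dist (Z p \<omega>) (Z q \<omega>) < e" by blast
    qed
    then show "convergent (\<lambda>n. Z n \<omega>)" by (rule Cauchy_convergent)
  qed
qed

text \<open>Fatou's lemma, since all \<open>Y n\<close> have the same mean. This excludes that \<open>Y\<close> tends to infinity, the one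
  case in which convergence of \<open>Z\<close> says too little.\<close>

lemma AE_liminf_finite: "AE \<omega> in M. liminf (\<lambda>n. ennreal (Y n \<omega>)) \<noteq> \<infinity>"
proof (rule nn_integral_PInf_AE)
  have const: "expectation (Y 0) = expectation (Y n)" for n
    using martingale[of "\<lambda>_. 1"] by (induction n) auto
  have "(\<integral>\<^sup>+ \<omega>. liminf (\<lambda>n. ennreal (Y n \<omega>)) \<partial>M) \<le> liminf (\<lambda>n. \<integral>\<^sup>+ \<omega>. ennreal (Y n \<omega>) \<partial>M)"
    by (rule nn_integral_liminf) auto
  also have "(\<lambda>n. \<integral>\<^sup>+ \<omega>. ennreal (Y n \<omega>) \<partial>M) = (\<lambda>_. ennreal (expectation (Y 0)))"
    using Y_integrable Y_nonneg const by (intro ext) (metis AE_I2 nn_integral_eq_integral)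
  finally show "(\<integral>\<^sup>+ \<omega>. liminf (\<lambda>n. ennreal (Y n \<omega>)) \<partial>M) \<noteq> \<infinity>"
    by (auto simp: top_unique Liminf_const)
qed auto

theorem AE_convergent: "AE \<omega> in M. convergent (\<lambda>n. Y n \<omega>)"
  using AE_Z_convergent AE_liminf_finite
proof eventually_elim
  fix \<omega> assume "convergent (\<lambda>n. Z n \<omega>)" and fin: "liminf (\<lambda>n. ennreal (Y n \<omega>)) \<noteq> \<infinity>"
  then obtain z where z: "(\<lambda>n. Z n \<omega>) \<longlonglongrightarrow> z" by (auto simp: convergent_def)
  have Y_eq: "Y n \<omega> = - ln (Z n \<omega>)" for n by (simp add: Z_def)
  have "0 \<le> z" using z Z_nonneg by (auto intro: LIMSEQ_le_const)
  moreover have "z \<noteq> 0"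
  proof
    assume "z = 0"
    then have "filterlim (\<lambda>n. Z n \<omega>) (at_right 0) sequentially"
      using z by (auto simp: filterlim_at Z_def)
    then have "filterlim (\<lambda>n. Y n \<omega>) at_top sequentially"
      unfolding Y_eq by (intro filterlim_compose[OF filterlim_uminus_at_top_at_bot] filterlim_compose[OF ln_at_0])
    then have "(\<lambda>n. ennreal (Y n \<omega>)) \<longlonglongrightarrow> \<infinity>"
      by (simp add: ennreal_tendsto_top_eq_at_top)
    then show False using fin lim_imp_Liminf[OF sequentially_bot, of "\<lambda>n. ennreal (Y n \<omega>)"] by blast
  qed
  ultimately have "(\<lambda>n. - ln (Z n \<omega>)) \<longlonglongrightarrow> - ln z"
    by (intro tendsto_minus tendsto_ln z)
  then show "convergent (\<lambda>n. Y n \<omega>)"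
    unfolding Y_eq by (rule convergentI)
qed

end

section \<open>Partitions and step functions\<close>

lemma chain_mono:
  fixes a :: "nat \<Rightarrow> real"
  assumes "\<And>i. i < n \<Longrightarrow> a i \<le> a (Suc i)" and "i \<le> j" "j \<le> n"
  shows "a i \<le> a j"
  using assms(2,3)
proof (induction rule: dec_induct)
  case (step k)
  then show ?case using assms(1)[of k] by auto
qed simp

lemma atLeastLessThan_chain:
  fixes a :: "nat \<Rightarrow> real"
  assumes "\<And>i. i < n \<Longrightarrow> a i \<le> a (Suc i)"
  shows "(\<Union>i<n. {a i..<a (Suc i)}) = {a 0..<a n}"
    and "disjoint_family_on (\<lambda>i. {a i..<a (Suc i)}) {..<n}"
proof -
  show "(\<Union>i<n. {a i..<a (Suc i)}) = {a 0..<a n}"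
    using assms
  proof (induction n)
    case (Suc n)
    have "a 0 \<le> a n" "a n \<le> a (Suc n)"
      using chain_mono[of "Suc n" a 0 n] Suc.prems by auto
    then show ?case
      using Suc by (simp add: lessThan_Suc ivl_disj_un_two(3) Un_commute)
  qed simp
  have "{a i..<a (Suc i)} \<inter> {a j..<a (Suc j)} = {}" if "i < j" "j < n" for i j
    using chain_mono[of n a "Suc i" j, OF assms] that by auto
  then show "disjoint_family_on (\<lambda>i. {a i..<a (Suc i)}) {..<n}"
    unfolding disjoint_family_on_def by (metis Int_commute lessThan_iff linorder_neqE_nat)
qed

lemma (in finite_measure) step_function_approximation:
  fixes f :: "'a \<Rightarrow> real" and n :: nat
  assumes "integrable M f"
    and C: "\<And>i. i < n \<Longrightarrow> C i \<in> sets M" "disjoint_family_on C {..<n}" "(\<Union>i<n. C i) = space M"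
    and close: "\<And>i x. i < n \<Longrightarrow> x \<in> C i \<Longrightarrow> \<bar>f x - c i\<bar> \<le> \<epsilon>"
  shows "\<bar>(\<integral>x. f x \<partial>M) - (\<Sum>i<n. c i * measure M (C i))\<bar> \<le> \<epsilon> * measure M (space M)"
proof -
  let ?s = "\<lambda>x. \<Sum>i<n. c i * indicator (C i) x"
  have int: "integrable M (\<lambda>x. c i * indicator (C i) x)" if "i < n" for i
    using C(1)[OF that] by (intro integrable_mult_right integrable_real_indicator) (auto simp: emeasure_eq_measure)
  have s: "?s x = c i" if "i < n" "x \<in> C i" for i x
  proof -
    have "?s x = (\<Sum>j<n. if j = i then c j else 0)"
      using C(2) that by (intro sum.cong) (auto simp: disjoint_family_on_def indicator_def)
    also have "\<dots> = c i" using that by (subst sum.delta) auto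
    finally show ?thesis .
  qed
  have "(\<integral>x. ?s x \<partial>M) = (\<Sum>i<n. \<integral>x. c i * indicator (C i) x \<partial>M)"
    using int by (intro Bochner_Integration.integral_sum) auto
  also have "\<dots> = (\<Sum>i<n. c i * measure M (C i))"
    using C(1) by (intro sum.cong) auto
  finally have "(\<integral>x. f x \<partial>M) - (\<Sum>i<n. c i * measure M (C i)) = (\<integral>x. f x \<partial>M) - (\<integral>x. ?s x \<partial>M)"
    by simp
  also have "\<dots> = (\<integral>x. f x - ?s x \<partial>M)"
    using assms(1) int by (intro Bochner_Integration.integral_diff[symmetric] Bochner_Integration.integrable_sum) auto
  also have "\<bar>\<dots>\<bar> \<le> (\<integral>x. \<bar>f x - ?s x\<bar> \<partial>M)"
    by (rule integral_abs_bound)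
  also have "\<dots> \<le> (\<integral>x. \<epsilon> \<partial>M)"
  proof (rule integral_mono)
    show "integrable M (\<lambda>x. \<bar>f x - ?s x\<bar>)"
      using assms(1) int by (intro integrable_abs Bochner_Integration.integrable_diff Bochner_Integration.integrable_sum) auto
    show "\<bar>f x - ?s x\<bar> \<le> \<epsilon>" if "x \<in> space M" for x
      using that C(3) close s by (metis UN_E lessThan_iff)
  qed simp
  finally show ?thesis by (simp add: mult.commute)
qed

section \<open>Measures from limiting distribution functions\<close>

text \<open>The generalised inverse of a distribution function on \<open>[0, 1]\<close> of which only the values at
  rational points matter. The supremum runs over a fixed countable set of bounded functions (\<open>0\<close>
  stands in for the points with \<open>G q > t\<close>, and is the value if there are no others), so it is
  measurable in \<open>G\<close> and \<open>t\<close> jointly, and its values stay in \<open>[0, 1]\<close>, for every function \<open>G\<close>.\<close>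

definition quantile :: "(real \<Rightarrow> real) \<Rightarrow> real \<Rightarrow> real" where
  "quantile G t = (SUP q\<in>\<rat> \<inter> {0..1}. if G q \<le> t then q else 0)"

lemma quantile_bdd: "bdd_above ((\<lambda>q. if G q \<le> t then q else (0::real)) ` (\<rat> \<inter> {0..1}))"
  by (rule bdd_aboveI[of _ 1]) auto

lemma quantile_ge: "q \<in> \<rat> \<Longrightarrow> q \<le> 1 \<Longrightarrow> G q \<le> t \<Longrightarrow> q \<le> quantile G t"
  and quantile_nonneg: "0 \<le> quantile G t"
  and quantile_le: "0 \<le> b \<Longrightarrow> (\<And>q. q \<in> \<rat> \<Longrightarrow> 0 \<le> q \<Longrightarrow> q \<le> 1 \<Longrightarrow> G q \<le> t \<Longrightarrow> q \<le> b) \<Longrightarrow> quantile G t \<le> b"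
proof -
  show nonneg: "0 \<le> quantile G t"
    unfolding quantile_def by (rule cSUP_upper2[where x = 0]) (auto intro: quantile_bdd)
  show "q \<le> quantile G t" if "q \<in> \<rat>" "q \<le> 1" "G q \<le> t"
  proof (cases "0 \<le> q")
    case True
    then show ?thesis
      unfolding quantile_def using that by (intro cSUP_upper2[where x = q]) (auto intro: quantile_bdd)
  qed (use nonneg in auto)
  show "quantile G t \<le> b" if "0 \<le> b" "\<And>q. q \<in> \<rat> \<Longrightarrow> 0 \<le> q \<Longrightarrow> q \<le> 1 \<Longrightarrow> G q \<le> t \<Longrightarrow> q \<le> b"
  proof -
    have "(0::real) \<in> \<rat> \<inter> {0..1}" by simp
    then show ?thesis
      unfolding quantile_def using that by (intro cSUP_least) (blast, auto)
  qed
qed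

lemma quantile_le_1: "quantile G t \<le> 1"
  by (rule quantile_le) auto

lemma measurable_quantile:
  assumes [measurable]: "\<And>q. (\<lambda>x. G x q) \<in> borel_measurable N" "T \<in> borel_measurable N"
  shows "(\<lambda>x. quantile (G x) (T x)) \<in> borel_measurable N"
  unfolding quantile_def
  by (rule borel_measurable_cSUP) (auto intro: quantile_bdd countable_Int1 countable_rat)

text \<open>For increasing \<open>G\<close>, the measure on \<open>[0, 1]\<close> whose distribution function is the right-continuous
  version of \<open>G\<close>, as the image of Lebesgue measure under the quantile function. For arbitrary \<open>G\<close> it is still some
  finite measure.\<close>

definition quantile_measure :: "(real \<Rightarrow> real) \<Rightarrow> real measure" where
  "quantile_measure G =
     distr (restrict_space lborel {0..<G 1}) (restrict_space borel {0..1}) (quantile G)"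

lemma quantile_in_unit_measurable:
  "quantile G \<in> measurable (restrict_space lborel {0..<G 1}) (restrict_space borel {0..1})"
  using quantile_nonneg quantile_le_1
  by (intro measurable_restrict_space2 measurable_restrict_space1 measurable_quantile) auto

lemma finite_measure_interval: "finite_measure (restrict_space lborel {0..<b::real})"
  by (cases "0 \<le> b") (auto intro!: finite_measureI simp: emeasure_restrict_space space_restrict_space)

lemma sets_quantile_measure: "sets (quantile_measure G) = sets (restrict_space borel {0..1})"
  by (simp add: quantile_measure_def)

lemma finite_measure_quantile_measure: "finite_measure (quantile_measure G)"
  unfolding quantile_measure_def
  by (intro finite_measure.finite_measure_distr finite_measure_interval quantile_in_unit_measurable)

text \<open>The measure of \<open>A\<close> is the length of a section of a measurable subset of \<open>\<Omega> \<times> \<real>\<close>, so it is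
  measurable in \<open>\<omega>\<close> by Fubini's theorem.\<close>

lemma random_finite_measure_quantile_measure:
  assumes [measurable]: "\<And>q. (\<lambda>\<omega>. G \<omega> q) \<in> borel_measurable M"
  shows "random_finite_measure M (\<lambda>\<omega>. quantile_measure (G \<omega>))"
  unfolding random_finite_measure_def
proof (intro conjI ballI finite_measure_quantile_measure sets_quantile_measure)
  fix A :: "real set" assume A: "A \<in> sets (restrict_space borel {0..1})"
  then have [measurable]: "A \<in> sets borel" by (auto simp: sets_restrict_space)
  have [measurable]: "(\<lambda>p. quantile (G (fst p)) (snd p)) \<in> borel_measurable (M \<Otimes>\<^sub>M lborel)"
    by (rule measurable_quantile) measurable
  define S where "S = {p \<in> space (M \<Otimes>\<^sub>M lborel). 0 \<le> snd p \<and> snd p < G (fst p) 1 \<and> quantile (G (fst p)) (snd p) \<in> A}"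
  have "S \<in> sets (M \<Otimes>\<^sub>M lborel)" unfolding S_def by measurable
  then have "(\<lambda>\<omega>. emeasure lborel (Pair \<omega> -` S)) \<in> borel_measurable M"
    by (rule lborel.measurable_emeasure_Pair)
  moreover have "emeasure (quantile_measure (G \<omega>)) A = emeasure lborel (Pair \<omega> -` S)" if "\<omega> \<in> space M" for \<omega>
  proof -
    have "Pair \<omega> -` S = quantile (G \<omega>) -` A \<inter> {0..<G \<omega> 1}"
      using that by (auto simp: S_def space_pair_measure)
    then show ?thesis
      unfolding quantile_measure_def
      using A quantile_in_unit_measurable[of "G \<omega>"]
      by (simp add: emeasure_distr emeasure_restrict_space space_restrict_space)
  qed
  ultimately show "(\<lambda>\<omega>. emeasure (quantile_measure (G \<omega>)) A) \<in> borel_measurable M"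
    by (simp cong: measurable_cong)
qed

text \<open>Both \<open>\<integral>g d\<mu>\<^sub>n\<close> and \<open>\<integral>g d\<nu>\<close> are, up to \<open>\<epsilon>\<close> times the total mass, Riemann--Stieltjes sums over one
  fine rational grid: for \<open>\<mu>\<^sub>n\<close> the cell \<open>(q\<^sub>i, q\<^sub>i\<^sub>+\<^sub>1]\<close> has mass \<open>\<mu>\<^sub>n[0, q\<^sub>i\<^sub>+\<^sub>1] - \<mu>\<^sub>n[0, q\<^sub>i]\<close>, and for
  the limit the parameters \<open>t \<in> [G q\<^sub>i, G q\<^sub>i\<^sub>+\<^sub>1)\<close> are sent into \<open>[q\<^sub>i, q\<^sub>i\<^sub>+\<^sub>1]\<close>. The finitely many masses
  converge by hypothesis.\<close>

lemma weakly_convergent_to_quantile_measure: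
  fixes \<mu> :: "nat \<Rightarrow> real measure"
  assumes fin: "\<And>n. finite_measure (\<mu> n)"
    and sets: "\<And>n. sets (\<mu> n) = sets (restrict_space borel {0..1})"
    and lim: "\<And>q. q \<in> \<rat> \<Longrightarrow> q \<le> 1 \<Longrightarrow> (\<lambda>n. measure (\<mu> n) {0..q}) \<longlonglongrightarrow> G q"
  shows "weakly_convergent_to \<mu> (quantile_measure G)"
  unfolding weakly_convergent_to_def
proof (intro allI impI LIMSEQ_I)
  fix g :: "real \<Rightarrow> real" and r :: real
  assume g: "continuous_on {0..1} g" and "0 < r"
  have in_sets: "{0..q} \<in> sets (\<mu> n)" if "q \<le> 1" for q n
    unfolding sets sets_restrict_space using that by (intro image_eqI[of _ _ "{0..q}"]) auto
  have space: "space (\<mu> n) = {0..1}" for n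
    using sets_eq_imp_space_eq[OF sets[of n]] by (simp add: space_restrict_space)
  have G_mono: "G p \<le> G q" if "p \<in> \<rat>" "q \<in> \<rat>" "p \<le> q" "q \<le> 1" for p q
    using that
    by (intro LIMSEQ_le[OF lim lim] exI[of _ 0] allI impI finite_measure.finite_measure_mono fin in_sets) auto
  have G_neg: "G q = 0" if "q \<in> \<rat>" "q < 0" for q
    using LIMSEQ_unique[OF lim[of q]] that by simp
  define T where "T = G 1"
  have "0 \<le> T" using G_neg[of "-1"] G_mono[of "-1" 1] by (simp add: T_def)
  \<comment> \<open>The error budget is \<open>\<epsilon> (T + 1)\<close> for \<open>\<mu>\<^sub>n\<close> with \<open>n\<close> large, \<open>\<epsilon> T\<close> for the limit, and \<open>\<epsilon>\<close> for the sums.\<close>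
  define \<epsilon> where "\<epsilon> = r / (2 * T + 2)"
  have "0 < \<epsilon>" using \<open>0 < r\<close> \<open>0 \<le> T\<close> by (simp add: \<epsilon>_def)

  have "uniformly_continuous_on {0..1} g"
    using g by (intro compact_uniformly_continuous) auto
  then obtain \<delta> where "0 < \<delta>"
    and \<delta>: "\<And>x y. x \<in> {0..1} \<Longrightarrow> y \<in> {0..1} \<Longrightarrow> \<bar>x - y\<bar> < \<delta> \<Longrightarrow> \<bar>g x - g y\<bar> < \<epsilon>"
    unfolding uniformly_continuous_on_def dist_real_def using \<open>0 < \<epsilon>\<close> by metis
  obtain N' where N': "inverse (real (Suc N')) < \<delta>"
    using reals_Archimedean[OF \<open>0 < \<delta>\<close>] by blast
  define N where "N = Suc N'"
  have "0 < N" "1 / real N < \<delta>" using N' by (auto simp: N_def inverse_eq_divide)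
  \<comment> \<open>The extra node \<open>-1/N\<close> gives a possible atom at the origin a cell of its own.\<close>
  define q where "q i = (real i - 1) / real N" for i
  have q_Rats: "q i \<in> \<rat>" for i by (simp add: q_def)
  have q_le: "q i \<le> q (Suc i)" for i using \<open>0 < N\<close> by (simp add: q_def field_simps)
  have q_nonneg: "0 \<le> q (Suc i)" for i by (simp add: q_def)
  have q_le_1: "q i \<le> 1" if "i \<le> Suc N" for i using that \<open>0 < N\<close> by (simp add: q_def field_simps)
  have q_step: "q (Suc i) - q i < \<delta>" for i using \<open>1 / real N < \<delta>\<close> by (simp add: q_def flip: diff_divide_distrib)
  have q_ends: "q 0 < 0" "q (Suc N) = 1" using \<open>0 < N\<close> by (auto simp: q_def)
  have g_close: "\<bar>g x - g (q (Suc i))\<bar> \<le> \<epsilon>" if "i < Suc N" "q i \<le> x" "x \<le> q (Suc i)" "x \<in> {0..1}" for i x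
    using that q_nonneg[of i] q_le_1[of "Suc i"] q_step[of i] by (intro less_imp_le \<delta>) auto
  obtain K where K: "\<And>x. x \<in> {0..1} \<Longrightarrow> \<bar>g x\<bar> \<le> K"
    using compact_imp_bounded[OF compact_continuous_image[OF g]] by (force simp: bounded_iff)
  have g_meas: "g \<in> borel_measurable (restrict_space borel {0..1})"
    using g by (rule borel_measurable_continuous_on_restrict)

  have \<mu>_approx: "\<bar>(\<integral>x. g x \<partial>\<mu> n) - (\<Sum>i<Suc N. g (q (Suc i)) * (measure (\<mu> n) {0..q (Suc i)} - measure (\<mu> n) {0..q i}))\<bar>
      \<le> \<epsilon> * measure (\<mu> n) {0..1}" for n
  proof -
    interpret finite_measure "\<mu> n" by (rule fin)
    let ?C = "\<lambda>i. {0..q (Suc i)} - {0..q i}"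
    have C: "?C i \<in> sets (\<mu> n)" "measure (\<mu> n) (?C i) = measure (\<mu> n) {0..q (Suc i)} - measure (\<mu> n) {0..q i}"
      if "i < Suc N" for i
      using that q_le[of i] q_le_1[of i] q_le_1[of "Suc i"] in_sets by (auto intro!: finite_measure_Diff)
    have "disjoint_family_on ?C {..<Suc N}"
    proof -
      have "?C i \<inter> ?C j = {}" if "i < j" "j < Suc N" for i j
        using chain_mono[of j q "Suc i" j, OF q_le] that by auto
      then show ?thesis
        unfolding disjoint_family_on_def by (metis Int_commute lessThan_iff linorder_neqE_nat)
    qed
    moreover have "(\<Union>i<m. ?C i) = {0..q m}" for m
    proof (induction m)
      case (Suc m)
      then show ?case using q_le[of m] by (auto simp: lessThan_Suc)
    qed (use q_ends in auto)
    moreover have "integrable (\<mu> n) g"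
      using K g_meas measurable_cong_sets[OF sets refl, of n] by (intro integrable_const_bound[of _ K]) (auto simp: space)
    moreover have "\<bar>g x - g (q (Suc i))\<bar> \<le> \<epsilon>" if "i < Suc N" "x \<in> ?C i" for i x
      using that q_le_1[of "Suc i"] by (intro g_close) auto
    ultimately have "\<bar>(\<integral>x. g x \<partial>\<mu> n) - (\<Sum>i<Suc N. g (q (Suc i)) * measure (\<mu> n) (?C i))\<bar>
        \<le> \<epsilon> * measure (\<mu> n) (space (\<mu> n))"
      using C q_ends by (intro step_function_approximation) (auto simp: space)
    moreover have "(\<Sum>i<Suc N. g (q (Suc i)) * measure (\<mu> n) (?C i))
        = (\<Sum>i<Suc N. g (q (Suc i)) * (measure (\<mu> n) {0..q (Suc i)} - measure (\<mu> n) {0..q i}))"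
      by (rule sum.cong) (simp_all only: lessThan_iff C(2))
    ultimately show ?thesis by (simp only: space)
  qed

  have limit_approx: "\<bar>(\<integral>x. g x \<partial>quantile_measure G) - (\<Sum>i<Suc N. g (q (Suc i)) * (G (q (Suc i)) - G (q i)))\<bar> \<le> \<epsilon> * T"
  proof -
    let ?L = "restrict_space lborel {0..<T}"
    interpret finite_measure ?L by (rule finite_measure_interval)
    let ?C = "\<lambda>i. {G (q i)..<G (q (Suc i))}"
    have Gq: "G (q i) \<le> G (q (Suc i))" if "i < Suc N" for i
      using that q_le q_le_1 q_Rats by (intro G_mono) auto
    have G_ends: "G (q 0) = 0" "G (q (Suc N)) = T"
      using q_ends q_Rats G_neg by (auto simp: T_def)
    have C: "(\<Union>i<Suc N. ?C i) = {0..<T}" "disjoint_family_on ?C {..<Suc N}"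
      using atLeastLessThan_chain[of "Suc N" "\<lambda>i. G (q i)", OF Gq] G_ends by auto
    have measure_L: "measure ?L A = measure lborel A" if "A \<subseteq> {0..<T}" for A
      using that by (intro measure_restrict_space) auto
    have in_L: "?C i \<in> sets ?L" "measure ?L (?C i) = G (q (Suc i)) - G (q i)" if "i < Suc N" for i
    proof -
      have sub: "?C i \<subseteq> {0..<T}" using C(1) that by blast
      then show "?C i \<in> sets ?L" by (auto simp: sets_restrict_space intro!: image_eqI[of _ _ "?C i"])
      show "measure ?L (?C i) = G (q (Suc i)) - G (q i)" using measure_L[OF sub] Gq[OF that] by simp
    qed
    have close: "\<bar>g (quantile G t) - g (q (Suc i))\<bar> \<le> \<epsilon>" if "i < Suc N" "t \<in> ?C i" for i t
    proof (rule g_close)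
      show "q i \<le> quantile G t"
        using that q_le_1[of i] q_Rats by (intro quantile_ge) auto
      show "quantile G t \<le> q (Suc i)"
      proof (rule quantile_le[OF q_nonneg])
        fix p :: real assume "p \<in> \<rat>" "p \<le> 1" "G p \<le> t"
        then show "p \<le> q (Suc i)"
          using G_mono[of "q (Suc i)" p] q_Rats that by force
      qed
      show "quantile G t \<in> {0..1}" using quantile_nonneg quantile_le_1 by auto
    qed (use that in auto)
    have Q: "quantile G \<in> measurable ?L (restrict_space borel {0..1})"
      unfolding T_def by (rule quantile_in_unit_measurable)
    have "integrable ?L (\<lambda>t. g (quantile G t))"
      using measurable_compose[OF Q g_meas] K quantile_nonneg[of G] quantile_le_1[of G]
      by (intro integrable_const_bound[of _ K]) auto
    then have "\<bar>(\<integral>t. g (quantile G t) \<partial>?L) - (\<Sum>i<Suc N. g (q (Suc i)) * measure ?L (?C i))\<bar>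
        \<le> \<epsilon> * measure ?L (space ?L)"
      using C in_L close by (intro step_function_approximation) (auto simp: space_restrict_space)
    moreover have "(\<integral>x. g x \<partial>quantile_measure G) = (\<integral>t. g (quantile G t) \<partial>?L)"
      unfolding quantile_measure_def T_def[symmetric] by (rule integral_distr[OF Q g_meas])
    moreover have "measure ?L (space ?L) = T"
      using measure_L[of "{0..<T}"] \<open>0 \<le> T\<close> by (simp add: space_restrict_space)
    moreover have "(\<Sum>i<Suc N. g (q (Suc i)) * measure ?L (?C i))
        = (\<Sum>i<Suc N. g (q (Suc i)) * (G (q (Suc i)) - G (q i)))"
      by (rule sum.cong) (simp_all only: lessThan_iff in_L(2))
    ultimately show ?thesis by (simp only:)
  qed

  have sums: "(\<lambda>n. \<Sum>i<Suc N. g (q (Suc i)) * (measure (\<mu> n) {0..q (Suc i)} - measure (\<mu> n) {0..q i}))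
      \<longlonglongrightarrow> (\<Sum>i<Suc N. g (q (Suc i)) * (G (q (Suc i)) - G (q i)))"
    using q_Rats q_le_1 by (intro tendsto_sum tendsto_mult_left tendsto_diff lim) auto
  obtain n1 where n1: "\<And>n. n \<ge> n1 \<Longrightarrow> \<bar>(\<Sum>i<Suc N. g (q (Suc i)) * (measure (\<mu> n) {0..q (Suc i)} - measure (\<mu> n) {0..q i}))
      - (\<Sum>i<Suc N. g (q (Suc i)) * (G (q (Suc i)) - G (q i)))\<bar> < \<epsilon>"
    using LIMSEQ_D[OF sums \<open>0 < \<epsilon>\<close>] by (auto simp only: real_norm_def)
  obtain n2 where n2: "\<And>n. n \<ge> n2 \<Longrightarrow> \<bar>measure (\<mu> n) {0..1} - T\<bar> < 1"
    using LIMSEQ_D[OF lim[of 1], of 1] by (auto simp: T_def)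
  have "\<bar>(\<integral>x. g x \<partial>\<mu> n) - (\<integral>x. g x \<partial>quantile_measure G)\<bar> < r" if "n \<ge> max n1 n2" for n
  proof -
    have "\<epsilon> * measure (\<mu> n) {0..1} \<le> \<epsilon> * (T + 1)"
      using n2[of n] that \<open>0 < \<epsilon>\<close> by (intro mult_left_mono) auto
    moreover have "\<epsilon> * (T + 1) + \<epsilon> * T + \<epsilon> = \<epsilon> * (2 * T + 2)"
      by (simp add: algebra_simps)
    moreover have "\<epsilon> * (2 * T + 2) = r"
      using \<open>0 \<le> T\<close> by (simp add: \<epsilon>_def)
    ultimately show ?thesis
      using \<mu>_approx[of n] limit_approx n1[of n] that by linarith
  qed
  then show "\<exists>no. \<forall>n\<ge>no. norm ((\<integral>x. g x \<partial>\<mu> n) - (\<integral>x. g x \<partial>quantile_measure G)) < r"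
    by (auto simp only: real_norm_def)
qed

section \<open>Words and adic intervals\<close>

lemma adic_left_snoc:
  "adic_left l (e @ [d]) = adic_left l e + real d / real l ^ Suc (length e)"
proof -
  have "(\<Sum>k=1..length e. real ((e @ [d]) ! (k - 1)) / real l ^ k) = (\<Sum>k=1..length e. real (e ! (k - 1)) / real l ^ k)"
    by (intro sum.cong) (auto simp: nth_append)
  then show ?thesis by (simp add: adic_left_def)
qed

text \<open>The left endpoints of the children of \<open>e\<close> form a chain that starts at the left endpoint of
  \<open>I\<^sub>e\<close> and advances by the length of a child each time.\<close>

lemma adic_interval_children:
  assumes "0 < l"
  shows "(\<Union>d<l. adic_interval l (e @ [d])) = adic_interval l e"
    and "disjoint_family_on (\<lambda>d. adic_interval l (e @ [d])) {..<l}"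
proof -
  define a where "a d = adic_left l e + real d / real l ^ Suc (length e)" for d
  have child: "adic_interval l (e @ [d]) = {a d..<a (Suc d)}" for d
    by (simp add: adic_interval_def adic_left_snoc a_def add_divide_distrib ac_simps)
  have parent: "adic_interval l e = {a 0..<a l}"
    using \<open>0 < l\<close> by (simp add: adic_interval_def a_def)
  have mono: "a d \<le> a (Suc d)" for d
    by (simp add: a_def divide_right_mono)
  show "(\<Union>d<l. adic_interval l (e @ [d])) = adic_interval l e"
    and "disjoint_family_on (\<lambda>d. adic_interval l (e @ [d])) {..<l}"
    unfolding child parent using atLeastLessThan_chain[of l a] mono by blast+
qed

lemma finite_words: "finite (words l n)"
  unfolding words_def using finite_lists_length_eq[of "{..<l}" n] by (simp add: conj_commute)

lemma sum_words_Suc: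
  "(\<Sum>e\<in>words l (Suc n). f e) = (\<Sum>e\<in>words l n. \<Sum>d<l. f (e @ [d]))"
proof -
  have "words l (Suc n) = (\<lambda>(e, d). e @ [d]) ` (words l n \<times> {..<l})"
  proof (intro set_eqI iffI)
    fix e assume "e \<in> words l (Suc n)"
    then show "e \<in> (\<lambda>(e, d). e @ [d]) ` (words l n \<times> {..<l})"
      by (cases e rule: rev_cases) (auto simp: words_def image_iff)
  qed (auto simp: words_def)
  moreover have "inj_on (\<lambda>(e, d). e @ [d]) (words l n \<times> {..<l})"
    by (auto simp: inj_on_def)
  ultimately show ?thesis
    by (simp add: sum.reindex sum.cartesian_product case_prod_unfold)
qed

section \<open>Masses of the cascade measures\<close>

definition path_weight :: "(nat list \<Rightarrow> 'a \<Rightarrow> real) \<Rightarrow> nat list \<Rightarrow> 'a \<Rightarrow> real" where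
  "path_weight V e \<omega> = (\<Prod>k=1..length e. V (take k e) \<omega>)"

lemma path_weight_snoc: "path_weight V (e @ [d]) \<omega> = path_weight V e \<omega> * V (e @ [d]) \<omega>"
  by (simp add: path_weight_def)

text \<open>The mass that the \<open>n\<close>-th cascade measure gives to \<open>B\<close>, written as a finite combination of
  path weights so that its conditional means can be computed term by term.\<close>

definition cascade_mass :: "nat \<Rightarrow> (nat list \<Rightarrow> 'a \<Rightarrow> real) \<Rightarrow> nat \<Rightarrow> real set \<Rightarrow> 'a \<Rightarrow> real" where
  "cascade_mass l V n B \<omega> = (\<Sum>e\<in>words l n. path_weight V e \<omega> * measure lborel (adic_interval l e \<inter> B))"

lemma adic_interval_sets [measurable]: "adic_interval l e \<in> sets borel"
  by (simp add: adic_interval_def)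

lemma fmeasurable_adic_interval: "B \<in> sets borel \<Longrightarrow> adic_interval l e \<inter> B \<in> fmeasurable lborel"
  by (rule fmeasurable_Int_fmeasurable) (auto simp: adic_interval_def intro!: fmeasurableI)

lemma measure_adic_interval_children:
  assumes "0 < l" "B \<in> sets borel"
  shows "measure lborel (adic_interval l e \<inter> B) = (\<Sum>d<l. measure lborel (adic_interval l (e @ [d]) \<inter> B))"
proof -
  have "adic_interval l e \<inter> B = (\<Union>d<l. adic_interval l (e @ [d]) \<inter> B)"
    using adic_interval_children(1)[OF \<open>0 < l\<close>, of e] by auto
  also have "measure lborel \<dots> = (\<Sum>d<l. measure lborel (adic_interval l (e @ [d]) \<inter> B))"
    using adic_interval_children(2)[OF \<open>0 < l\<close>, of e] fmeasurable_adic_interval[OF assms(2)]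
    by (intro measure_UNION') (auto simp: disjoint_family_on_def pairwise_def disjnt_def)
  finally show ?thesis .
qed

lemma emeasure_cascade_measure:
  assumes "\<And>e. 0 \<le> V e \<omega>" and B: "B \<in> sets borel" "B \<subseteq> {0..1}"
  shows "emeasure (cascade_measure l V n \<omega>) B = ennreal (cascade_mass l V n B \<omega>)"
proof -
  have pw: "0 \<le> path_weight V e \<omega>" for e
    using assms by (simp add: path_weight_def prod_nonneg)
  have density: "cascade_density l V n \<omega> x = (\<Sum>e\<in>words l n. path_weight V e \<omega> * indicator (adic_interval l e) x)" for x
    unfolding cascade_density_def path_weight_def by (intro sum.cong) (auto simp: words_def)
  have [measurable]: "(\<lambda>x. cascade_density l V n \<omega> x) \<in> borel_measurable borel"
    unfolding density by measurable
  have "B \<in> sets (restrict_space lborel {0..1})"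
    using B by (auto simp: sets_restrict_space intro!: image_eqI[of _ _ B])
  then have "emeasure (cascade_measure l V n \<omega>) B
      = (\<integral>\<^sup>+ x. ennreal (cascade_density l V n \<omega> x) * indicator B x \<partial>restrict_space lborel {0..1})"
    unfolding cascade_measure_def
    by (intro emeasure_density measurable_restrict_space1) auto
  also have "\<dots> = (\<integral>\<^sup>+ x. ennreal (cascade_density l V n \<omega> x) * indicator B x * indicator {0..1} x \<partial>lborel)"
    by (subst nn_integral_restrict_space) auto
  also have "\<dots> = (\<integral>\<^sup>+ x. (\<Sum>e\<in>words l n. ennreal (path_weight V e \<omega>) * indicator (adic_interval l e \<inter> B) x) \<partial>lborel)"
  proof (intro nn_integral_cong)
    fix x
    have "ennreal (cascade_density l V n \<omega> x) = (\<Sum>e\<in>words l n. ennreal (path_weight V e \<omega>) * indicator (adic_interval l e) x)"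
      unfolding density using pw
      by (subst sum_ennreal[symmetric]) (auto intro!: sum.cong simp: ennreal_mult ennreal_indicator)
    then show "ennreal (cascade_density l V n \<omega> x) * indicator B x * indicator {0..1} x
        = (\<Sum>e\<in>words l n. ennreal (path_weight V e \<omega>) * indicator (adic_interval l e \<inter> B) x)"
      using B(2) by (auto simp: indicator_def sum_distrib_right intro!: sum.cong split: if_splits)
  qed
  also have "\<dots> = (\<Sum>e\<in>words l n. ennreal (path_weight V e \<omega>) * emeasure lborel (adic_interval l e \<inter> B))"
    using B by (simp add: nn_integral_sum nn_integral_cmult)
  also have "\<dots> = (\<Sum>e\<in>words l n. ennreal (path_weight V e \<omega> * measure lborel (adic_interval l e \<inter> B)))"
    using pw fmeasurable_adic_interval[OF B(1)]
    by (intro sum.cong) (auto simp: ennreal_mult emeasure_eq_measure2)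
  also have "\<dots> = ennreal (cascade_mass l V n B \<omega>)"
    unfolding cascade_mass_def using pw by (intro sum_ennreal) auto
  finally show ?thesis .
qed

lemma cascade_mass_nonneg: "(\<And>e. 0 \<le> V e \<omega>) \<Longrightarrow> 0 \<le> cascade_mass l V n B \<omega>"
  by (auto simp: cascade_mass_def path_weight_def intro!: sum_nonneg mult_nonneg_nonneg prod_nonneg)

section \<open>The mass martingales of a cascade\<close>

locale cascade = prob_space M for M :: "'a measure" +
  fixes l :: nat and V :: "nat list \<Rightarrow> 'a \<Rightarrow> real"
  assumes l_pos: "0 < l"
    and V_nonneg: "\<And>e \<omega>. 0 \<le> V e \<omega>"
    and V_indep: "indep_vars (\<lambda>_. borel) V (nonempty_words l)"
    and V_integrable: "\<And>e. e \<in> nonempty_words l \<Longrightarrow> integrable M (V e)"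
    and V_mean: "\<And>e. e \<in> nonempty_words l \<Longrightarrow> expectation (V e) = 1"
begin

text \<open>The \<open>\<sigma>\<close>-algebra generated by the weights \<open>V e\<close> with \<open>e \<in> K\<close>, as the pullback of the product
  \<open>\<sigma>\<close>-algebra along the tuple of these weights: this is the form in which independence of
  disjoint blocks of the family is available.\<close>

definition generated :: "nat list set \<Rightarrow> 'a measure" where
  "generated K = vimage_algebra (space M) (\<lambda>\<omega>. \<lambda>e\<in>K. V e \<omega>) (Pi\<^sub>M K (\<lambda>_. borel))"

definition past_words :: "nat \<Rightarrow> nat list set" where
  "past_words n = {e \<in> nonempty_words l. length e \<le> n}"

abbreviation past :: "nat \<Rightarrow> 'a measure" where
  "past n \<equiv> generated (past_words n)"

lemma V_measurable: "e \<in> nonempty_words l \<Longrightarrow> V e \<in> borel_measurable M"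
  using V_integrable by auto

lemma tuple_measurable:
  "K \<subseteq> nonempty_words l \<Longrightarrow> (\<lambda>\<omega>. \<lambda>e\<in>K. V e \<omega>) \<in> measurable M (Pi\<^sub>M K (\<lambda>_. borel))"
  by (intro measurable_restrict V_measurable) auto

lemma space_generated: "space (generated K) = space M"
  by (simp add: generated_def)

lemma subalgebra_past: "subalgebra M (past n)"
  unfolding subalgebra_def generated_def
  using sets_image_in_sets[OF refl tuple_measurable[of "past_words n"]] by (auto simp: past_words_def)

lemma V_generated_measurable:
  assumes "K \<subseteq> nonempty_words l" "e \<in> K"
  shows "V e \<in> borel_measurable (generated K)"
proof -
  have "(\<lambda>\<omega>. \<lambda>e\<in>K. V e \<omega>) \<in> measurable (generated K) (Pi\<^sub>M K (\<lambda>_. borel))"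
    unfolding generated_def
    by (rule measurable_vimage_algebra1) (use measurable_space[OF tuple_measurable] assms in auto)
  from measurable_compose[OF this measurable_component_singleton[OF assms(2)]] show ?thesis
    using assms by simp
qed

lemma sigma_sets_vimage_subset_generated:
  assumes "h \<in> borel_measurable (generated K)"
  shows "sigma_sets (space M) {h -` A \<inter> space M |A. A \<in> sets borel} \<subseteq> sets (generated K)"
proof -
  have "{h -` A \<inter> space M |A. A \<in> sets borel} \<subseteq> sets (generated K)"
    using measurable_sets[OF assms] by (auto simp: space_generated)
  from sets.sigma_sets_subset[OF this] show ?thesis
    by (simp add: space_generated)
qed

lemma past_measurable_imp_M: "h \<in> borel_measurable (past n) \<Longrightarrow> h \<in> borel_measurable M"
  using subalgebra_past measurable_from_subalg by blast

lemma child_in_nonempty_words: "e \<in> words l n \<Longrightarrow> d < l \<Longrightarrow> e @ [d] \<in> nonempty_words l"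
  unfolding nonempty_words_def words_def by auto

text \<open>Independence of the family is independence of disjoint blocks of it; \<open>h\<close> only sees the block
  of words of length at most \<open>n\<close>, to which \<open>e\<close> does not belong.\<close>

lemma indep_past_next:
  assumes h: "h \<in> borel_measurable (past n)" and e: "e \<in> nonempty_words l" "n < length e"
  shows "indep_var borel h borel (V e)"
proof -
  have "indep_var (Pi\<^sub>M (past_words n) (\<lambda>_. borel)) (\<lambda>\<omega>. \<lambda>e\<in>past_words n. V e \<omega>)
      (Pi\<^sub>M {e} (\<lambda>_. borel)) (\<lambda>\<omega>. \<lambda>e\<in>{e}. V e \<omega>)"
    using e by (intro indep_var_restrict[OF V_indep]) (auto simp: past_words_def)
  then have "indep_set (sets (past n)) (sets (generated {e}))"
    unfolding indep_var_eq generated_def sets_vimage_algebra by simp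
  moreover have "V e \<in> borel_measurable (generated {e})"
    using e by (intro V_generated_measurable) auto
  ultimately have "indep_set (sigma_sets (space M) {h -` A \<inter> space M |A. A \<in> sets borel})
      (sigma_sets (space M) {V e -` A \<inter> space M |A. A \<in> sets borel})"
    using sigma_sets_vimage_subset_generated h unfolding indep_set_def
    by (elim indep_sets_mono_sets) (auto split: bool.split)
  then show ?thesis
    unfolding indep_var_eq using V_measurable[OF e(1)] past_measurable_imp_M[OF h] by simp
qed

lemma path_weight_past_measurable:
  "e \<in> words l i \<Longrightarrow> i \<le> n \<Longrightarrow> path_weight V e \<in> borel_measurable (past n)"
proof (induction i arbitrary: e)
  case 0
  then show ?case by (simp add: words_def path_weight_def)
next
  case (Suc i)
  then obtain e' d where e: "e = e' @ [d]" "e' \<in> words l i" "d < l"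
    by (cases e rule: rev_cases) (auto simp: words_def)
  then have "e \<in> past_words n"
    using Suc.prems child_in_nonempty_words by (auto simp: past_words_def words_def)
  then show ?case
    using Suc.IH[of e'] Suc.prems e V_generated_measurable[of "past_words n" e]
    by (auto simp: path_weight_snoc[abs_def] past_words_def)
qed

lemma path_weight_integrable: "e \<in> words l n \<Longrightarrow> integrable M (path_weight V e)"
proof (induction n arbitrary: e)
  case 0
  then show ?case by (simp add: words_def path_weight_def)
next
  case (Suc n)
  then obtain e' d where e: "e = e' @ [d]" "e' \<in> words l n" "d < l"
    by (cases e rule: rev_cases) (auto simp: words_def)
  have "indep_var borel (path_weight V e') borel (V e)"
    using e child_in_nonempty_words path_weight_past_measurable[of e' n n]
    by (intro indep_past_next) (auto simp: words_def)
  then have "integrable M (\<lambda>\<omega>. path_weight V e' \<omega> * V e \<omega>)"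
    using e Suc.IH V_integrable child_in_nonempty_words by (intro indep_var_integrable) auto
  then show ?case by (simp add: e path_weight_snoc cong: Bochner_Integration.integrable_cong)
qed

lemma cascade_mass_past_measurable: "i \<le> n \<Longrightarrow> cascade_mass l V i B \<in> borel_measurable (past n)"
  unfolding cascade_mass_def[abs_def]
  by (intro borel_measurable_sum borel_measurable_times path_weight_past_measurable) auto

lemma integrable_tested_path_weight:
  assumes h: "h \<in> borel_measurable (past n)" "\<And>\<omega>. 0 \<le> h \<omega>" "\<And>\<omega>. h \<omega> \<le> 1" and e: "e \<in> words l n"
  shows "integrable M (\<lambda>\<omega>. h \<omega> * path_weight V e \<omega>)"
proof (rule Bochner_Integration.integrable_bound[OF path_weight_integrable[OF e]])
  show "(\<lambda>\<omega>. h \<omega> * path_weight V e \<omega>) \<in> borel_measurable M"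
    using past_measurable_imp_M[OF h(1)] path_weight_integrable[OF e] by auto
  show "AE \<omega> in M. norm (h \<omega> * path_weight V e \<omega>) \<le> norm (path_weight V e \<omega>)"
    using h by (auto simp: abs_mult intro!: AE_I2 mult_left_le_one_le)
qed

text \<open>The factor that the child adds to the weight of its parent has mean one and is independent of
  everything that precedes it, the test variable \<open>h\<close> included.\<close>

lemma expectation_path_weight_child:
  assumes h: "h \<in> borel_measurable (past n)" "\<And>\<omega>. 0 \<le> h \<omega>" "\<And>\<omega>. h \<omega> \<le> 1"
    and e: "e \<in> words l n" "d < l"
  shows "integrable M (\<lambda>\<omega>. h \<omega> * path_weight V (e @ [d]) \<omega>)"
    and "expectation (\<lambda>\<omega>. h \<omega> * path_weight V (e @ [d]) \<omega>) = expectation (\<lambda>\<omega>. h \<omega> * path_weight V e \<omega>)"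
proof -
  have hw: "(\<lambda>\<omega>. h \<omega> * path_weight V e \<omega>) \<in> borel_measurable (past n)"
    using h path_weight_past_measurable[of e n n] e by auto
  have ind: "indep_var borel (\<lambda>\<omega>. h \<omega> * path_weight V e \<omega>) borel (V (e @ [d]))"
    using e child_in_nonempty_words by (intro indep_past_next[OF hw]) (auto simp: words_def)
  note int = integrable_tested_path_weight[OF h e(1)]
  note child = V_integrable[OF child_in_nonempty_words[OF e]] V_mean[OF child_in_nonempty_words[OF e]]
  have eq: "(\<lambda>\<omega>. h \<omega> * path_weight V (e @ [d]) \<omega>) = (\<lambda>\<omega>. h \<omega> * path_weight V e \<omega> * V (e @ [d]) \<omega>)"
    by (simp add: path_weight_snoc mult.assoc)
  show "integrable M (\<lambda>\<omega>. h \<omega> * path_weight V (e @ [d]) \<omega>)"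
    unfolding eq by (rule indep_var_integrable[OF ind int child(1)])
  show "expectation (\<lambda>\<omega>. h \<omega> * path_weight V (e @ [d]) \<omega>) = expectation (\<lambda>\<omega>. h \<omega> * path_weight V e \<omega>)"
    unfolding eq using indep_var_lebesgue_integral[OF ind int child(1)] child by simp
qed

text \<open>Passing from level \<open>n\<close> to level \<open>n + 1\<close> splits the length of each piece \<open>I\<^sub>e \<inter> B\<close> among the
  children of \<open>e\<close>, and on average does not change the weights. An
  arbitrary Borel set \<open>B\<close> makes this available for \<open>{0..q}\<close> with every rational \<open>q\<close>.\<close>

lemma cascade_mass_martingale:
  assumes B: "B \<in> sets borel"
  shows "nonneg_martingale M past (\<lambda>n. cascade_mass l V n B)"
proof
  show "subalgebra M (past n)" for n by (rule subalgebra_past)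
  show "cascade_mass l V i B \<in> borel_measurable (past n)" if "i \<le> n" for i n
    using that by (rule cascade_mass_past_measurable)
  show "integrable M (cascade_mass l V n B)" for n
    unfolding cascade_mass_def[abs_def]
    by (intro Bochner_Integration.integrable_sum integrable_mult_left path_weight_integrable) auto
  show "0 \<le> cascade_mass l V n B \<omega>" for n \<omega>
    by (rule cascade_mass_nonneg) (rule V_nonneg)
  fix n h assume h: "h \<in> borel_measurable (past n)" "\<And>\<omega>. 0 \<le> h \<omega>" "\<And>\<omega>. h \<omega> \<le> (1::real)"
  let ?len = "\<lambda>e. measure lborel (adic_interval l e \<inter> B)"
  note child = expectation_path_weight_child[OF h]
  note parent = integrable_tested_path_weight[OF h]
  have "expectation (\<lambda>\<omega>. h \<omega> * cascade_mass l V (Suc n) B \<omega>)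
      = expectation (\<lambda>\<omega>. \<Sum>e\<in>words l n. \<Sum>d<l. (h \<omega> * path_weight V (e @ [d]) \<omega>) * ?len (e @ [d]))"
    by (simp add: cascade_mass_def sum_words_Suc sum_distrib_left mult.assoc)
  also have "\<dots> = (\<Sum>e\<in>words l n. expectation (\<lambda>\<omega>. \<Sum>d<l. (h \<omega> * path_weight V (e @ [d]) \<omega>) * ?len (e @ [d])))"
    using child(1) by (intro Bochner_Integration.integral_sum Bochner_Integration.integrable_sum integrable_mult_left) auto
  also have "\<dots> = (\<Sum>e\<in>words l n. \<Sum>d<l. expectation (\<lambda>\<omega>. (h \<omega> * path_weight V (e @ [d]) \<omega>) * ?len (e @ [d])))"
    using child(1) by (intro sum.cong refl Bochner_Integration.integral_sum integrable_mult_left) auto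
  also have "\<dots> = (\<Sum>e\<in>words l n. \<Sum>d<l. expectation (\<lambda>\<omega>. h \<omega> * path_weight V (e @ [d]) \<omega>) * ?len (e @ [d]))"
    by simp
  also have "\<dots> = (\<Sum>e\<in>words l n. expectation (\<lambda>\<omega>. h \<omega> * path_weight V e \<omega>) * ?len e)"
  proof (rule sum.cong[OF refl])
    fix e assume "e \<in> words l n"
    then have "(\<Sum>d<l. expectation (\<lambda>\<omega>. h \<omega> * path_weight V (e @ [d]) \<omega>) * ?len (e @ [d]))
        = (\<Sum>d<l. expectation (\<lambda>\<omega>. h \<omega> * path_weight V e \<omega>) * ?len (e @ [d]))"
      using child(2) by (intro sum.cong) auto
    then show "(\<Sum>d<l. expectation (\<lambda>\<omega>. h \<omega> * path_weight V (e @ [d]) \<omega>) * ?len (e @ [d]))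
        = expectation (\<lambda>\<omega>. h \<omega> * path_weight V e \<omega>) * ?len e"
      by (simp only: measure_adic_interval_children[OF l_pos B, of e] sum_distrib_left)
  qed
  also have "\<dots> = expectation (\<lambda>\<omega>. \<Sum>e\<in>words l n. (h \<omega> * path_weight V e \<omega>) * ?len e)"
    using parent by (subst Bochner_Integration.integral_sum) auto
  also have "\<dots> = expectation (\<lambda>\<omega>. h \<omega> * cascade_mass l V n B \<omega>)"
    by (simp add: cascade_mass_def sum_distrib_left mult.assoc)
  finally show "expectation (\<lambda>\<omega>. h \<omega> * cascade_mass l V (Suc n) B \<omega>)
      = expectation (\<lambda>\<omega>. h \<omega> * cascade_mass l V n B \<omega>)" .
qed

text \<open>Almost surely this is a true limit for all rational \<open>q\<close> at once. On the exceptional null set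
  \<open>lim\<close> still yields some measurable function of \<open>\<omega>\<close>, which is enough to define a random measure
  on the whole sample space.\<close>

definition limit_mass :: "'a \<Rightarrow> real \<Rightarrow> real" where
  "limit_mass \<omega> q = lim (\<lambda>n. cascade_mass l V n {0..q} \<omega>)"

lemma limit_mass_measurable: "(\<lambda>\<omega>. limit_mass \<omega> q) \<in> borel_measurable M"
  unfolding limit_mass_def
  by (rule borel_measurable_lim_metric) (rule past_measurable_imp_M[OF cascade_mass_past_measurable[OF order_refl]])

lemma AE_cascade_mass_converges:
  "AE \<omega> in M. \<forall>q\<in>\<rat>. (\<lambda>n. cascade_mass l V n {0..q} \<omega>) \<longlonglongrightarrow> limit_mass \<omega> q"
proof (subst AE_ball_countable, rule countable_rat, intro ballI)
  fix q :: real
  interpret nonneg_martingale M past "\<lambda>n. cascade_mass l V n {0..q}"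
    by (rule cascade_mass_martingale) simp
  show "AE \<omega> in M. (\<lambda>n. cascade_mass l V n {0..q} \<omega>) \<longlonglongrightarrow> limit_mass \<omega> q"
    using AE_convergent unfolding limit_mass_def convergent_LIMSEQ_iff .
qed

theorem cascade_converges_weakly:
  "random_finite_measure M (\<lambda>\<omega>. quantile_measure (limit_mass \<omega>))"
  "AE \<omega> in M. weakly_convergent_to (\<lambda>n. cascade_measure l V n \<omega>) (quantile_measure (limit_mass \<omega>))"
proof -
  show "random_finite_measure M (\<lambda>\<omega>. quantile_measure (limit_mass \<omega>))"
    by (rule random_finite_measure_quantile_measure) (rule limit_mass_measurable)
  show "AE \<omega> in M. weakly_convergent_to (\<lambda>n. cascade_measure l V n \<omega>) (quantile_measure (limit_mass \<omega>))"
    using AE_cascade_mass_converges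
  proof eventually_elim
    fix \<omega> assume lim: "\<forall>q\<in>\<rat>. (\<lambda>n. cascade_mass l V n {0..q} \<omega>) \<longlonglongrightarrow> limit_mass \<omega> q"
    have emeasure: "emeasure (cascade_measure l V n \<omega>) {0..q} = ennreal (cascade_mass l V n {0..q} \<omega>)"
      if "q \<le> 1" for n q
      using that V_nonneg by (intro emeasure_cascade_measure) auto
    show "weakly_convergent_to (\<lambda>n. cascade_measure l V n \<omega>) (quantile_measure (limit_mass \<omega>))"
    proof (rule weakly_convergent_to_quantile_measure)
      show "finite_measure (cascade_measure l V n \<omega>)" for n
        using emeasure[of 1 n] by (intro finite_measureI) (simp add: cascade_measure_def space_restrict_space)
      show "sets (cascade_measure l V n \<omega>) = sets (restrict_space borel {0..1})" for n
        by (simp add: cascade_measure_def sets_restrict_space)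
      show "(\<lambda>n. measure (cascade_measure l V n \<omega>) {0..q}) \<longlonglongrightarrow> limit_mass \<omega> q" if "q \<in> \<rat>" "q \<le> 1" for q
        using lim that emeasure[OF that(2)] V_nonneg by (simp add: measure_def cascade_mass_nonneg)
    qed
  qed
qed

end

section \<open>Weak convergence of the cascade\<close>

theorem theorem1:
  fixes M :: "'a measure" and l :: nat
    and W :: "'a \<Rightarrow> real" and V :: "nat list \<Rightarrow> 'a \<Rightarrow> real"
  assumes "prob_space M"
    and "l \<ge> 2"
    and "W \<in> borel_measurable M"
    and "AE \<omega> in M. W \<omega> \<ge> 0"
    and "integrable M W"
    and "prob_space.expectation M W = 1"
    and "prob_space.indep_vars M (\<lambda>_. borel) V (nonempty_words l)"
    and "\<And>e. e \<in> nonempty_words l \<Longrightarrow> distr M borel (V e) = distr M borel W"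
  shows "\<exists>m. random_finite_measure M m \<and>
           (AE \<omega> in M. weakly_convergent_to (\<lambda>n. cascade_measure l V n \<omega>) (m \<omega>))"
proof -
  interpret prob_space M by fact
  \<comment> \<open>The weights are non-negative only almost surely; truncating them makes all masses
    non-negative everywhere and changes the cascade on a null set only.\<close>
  define V' where "V' e \<omega> = max 0 (V e \<omega>)" for e \<omega>
  have V_meas: "V e \<in> borel_measurable M" if "e \<in> nonempty_words l" for e
    using assms(7) that unfolding indep_vars_def by auto
  have V_nonneg: "AE \<omega> in M. 0 \<le> V e \<omega>" if e: "e \<in> nonempty_words l" for e
  proof -
    have "AE x in distr M borel W. 0 \<le> x"
      using assms(3,4) by (subst AE_distr_iff) auto
    then have "AE x in distr M borel (V e). 0 \<le> x"
      by (simp only: assms(8)[OF e])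
    then show ?thesis
      using V_meas[OF e] by (subst (asm) AE_distr_iff) auto
  qed
  have V'_eq: "AE \<omega> in M. V' e \<omega> = V e \<omega>" if "e \<in> nonempty_words l" for e
    using V_nonneg[OF that] by eventually_elim (simp add: V'_def)
  have V'_meas: "V' e \<in> borel_measurable M" if "e \<in> nonempty_words l" for e
    unfolding V'_def using V_meas[OF that] by measurable
  have V_mean: "integrable M (V e)" "expectation (V e) = 1" if e: "e \<in> nonempty_words l" for e
  proof -
    have "integrable (distr M borel (V e)) (\<lambda>x. x)"
      unfolding assms(8)[OF e] using assms(3,5) by (simp add: integrable_distr_eq)
    then show "integrable M (V e)"
      using V_meas[OF e] by (simp add: integrable_distr_eq)
    have "(\<integral>x. x \<partial>distr M borel (V e)) = 1"
      unfolding assms(8)[OF e] using assms(3,6) by (simp add: integral_distr)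
    then show "expectation (V e) = 1"
      using V_meas[OF e] by (simp add: integral_distr)
  qed
  interpret V': cascade M l V'
  proof
    show "0 < l" using assms(2) by simp
    show "0 \<le> V' e \<omega>" for e \<omega> by (simp add: V'_def)
    show "indep_vars (\<lambda>_. borel) V' (nonempty_words l)"
      unfolding V'_def[abs_def] by (rule indep_vars_compose2[OF assms(7)]) measurable
    show "integrable M (V' e)" if "e \<in> nonempty_words l" for e
      using integrable_cong_AE[OF V'_meas V_meas V'_eq] V_mean that by blast
    show "expectation (V' e) = 1" if "e \<in> nonempty_words l" for e
      using integral_cong_AE[OF V'_meas V_meas V'_eq] V_mean that by metis
  qed
  have "countable (nonempty_words l)" by (rule countableI_type)
  then have "AE \<omega> in M. \<forall>e\<in>nonempty_words l. V' e \<omega> = V e \<omega>"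
    using V'_eq by (subst AE_ball_countable) auto
  then have "AE \<omega> in M. \<forall>n. cascade_measure l V' n \<omega> = cascade_measure l V n \<omega>"
  proof eventually_elim
    fix \<omega> assume eq: "\<forall>e\<in>nonempty_words l. V' e \<omega> = V e \<omega>"
    have "V' (take k e) \<omega> = V (take k e) \<omega>" if "e \<in> words l n" "k \<in> {1..n}" for n k e
    proof -
      have "take k e \<in> words l k"
        using that set_take_subset[of k e] by (auto simp: words_def)
      then show ?thesis using eq that by (auto simp: nonempty_words_def)
    qed
    then have "cascade_density l V' n \<omega> x = cascade_density l V n \<omega> x" for n x
      unfolding cascade_density_def by (intro sum.cong arg_cong2[where f = "(*)"] prod.cong) auto
    then show "\<forall>n. cascade_measure l V' n \<omega> = cascade_measure l V n \<omega>"
      by (simp add: cascade_measure_def)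
  qed
  then have "AE \<omega> in M. weakly_convergent_to (\<lambda>n. cascade_measure l V n \<omega>) (quantile_measure (V'.limit_mass \<omega>))"
    using V'.cascade_converges_weakly(2) by eventually_elim simp
  then show ?thesis
    using V'.cascade_converges_weakly(1) by blast
qed

end
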